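(* Let $E$ be an AL-space and let $\mathcal{T} = (T_t)_{t \in J}$ be a bounded positive semigroup on $E$, where either $J = \mathbb{N}$ or $J = (0,\infty)$. Then the following assertions are equivalent: (i) $\mathcal{T}$ converges strongly (as $t\to\infty$) to the rank-1 projection $P=\varphi \otimes f_0$, where $f_0\in E_+$ is a normalised fixed vector of $\mathcal{T}$ and $\varphi\in E'$ is a positive fixed functional of $\mathcal{T}$ such that $\langle\varphi, f_0\rangle =1$ and $\langle\varphi, f\rangle \geq \varepsilon$ for all $f \in E_+$ of norm $1$ and some constant $\varepsilon > 0$. (ii) There exists a non-zero lower bound $h$ for $\mathcal{T}$.
   Context: All spaces are real. $\mathbb{N} = \{1,2,\dots\}$. An AL-space is a Banach lattice $E$ with $\|f+g\| = \|f\|+\|g\|$ for all $f,g \in E_+$, where $E_+$ is the positive cone. A semigroup on $E$ is a family $(T_t)_{t \in J}$ of bounded linear operators on $E$ with $T_{t+s} = T_tT_s$ for all $s,t \in J$; no continuity in $t$ is assumed. It is bounded if $\sup_{t\in J}\|T_t\|<\infty$, and positive if $T_tE_+\subseteq E_+$ for all $t \in J$. A fixed vector is $f \in E$ with $T_tf = f$ for all $t \in J$; a fixed functional is $\varphi \in E'$ (the dual space) with $T_t'\varphi = \varphi$ for all $t\in J$, where $T_t'$ is the adjoint. $(\varphi\otimes f_0)g = \langle \varphi,g\rangle f_0$. Normalised means of norm $1$. Strong convergence means convergence in the strong operator topology. A lower bound for a positive semigroup $\mathcal{T}$ is a vector $h \in E_+$ such that $\|(T_tf-h)^-\| \to 0$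 as $t \to \infty$ for every $f \in E_+$ with $\|f\|=1$; here $g^- = (-g)\vee 0$. *)

theory Defs
  imports "HOL-Analysis.Analysis" "HOL-Library.Lattice_Algebras"
begin

text \<open>The modulus of \<open>x\<close> is written \<open>sup x (- x)\<close>.\<close>

class banach_lattice = banach + ordered_real_vector + lattice_ab_group_add +
  assumes norm_lattice: "sup x (- x) \<le> sup y (- y) \<Longrightarrow> norm x \<le> norm y"

class al_space = banach_lattice +
  assumes norm_add_nonneg: "0 \<le> x \<Longrightarrow> 0 \<le> y \<Longrightarrow> norm (x + y) = norm x + norm y"

instance real :: al_space
  by standard (auto simp: sup_real_def split: if_splits)

definition neg_part :: "'a::banach_lattice \<Rightarrow> 'a"
  where "neg_part g = sup (- g) 0"

text \<open>
  Time sets are represented as sets of reals, so that the discrete and the continuous case are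
  treated uniformly: \<open>real ` {1..}\<close> is the set of natural numbers \<open>1, 2, \<dots>\<close>. Only the values of a
  family on its time set are relevant.
\<close>

definition operator_semigroup :: "real set \<Rightarrow> (real \<Rightarrow> 'a::real_normed_vector \<Rightarrow>\<^sub>L 'a) \<Rightarrow> bool"
  where "operator_semigroup J T \<longleftrightarrow> (\<forall>s\<in>J. \<forall>t\<in>J. T (t + s) = T t o\<^sub>L T s)"

definition bounded_family :: "real set \<Rightarrow> (real \<Rightarrow> 'a::real_normed_vector \<Rightarrow>\<^sub>L 'a) \<Rightarrow> bool"
  where "bounded_family J T \<longleftrightarrow> bdd_above ((\<lambda>t. norm (T t)) ` J)"

definition positive_family :: "real set \<Rightarrow> (real \<Rightarrow> 'a::banach_lattice \<Rightarrow>\<^sub>L 'a) \<Rightarrow> bool"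
  where "positive_family J T \<longleftrightarrow> (\<forall>t\<in>J. \<forall>f\<ge>0. 0 \<le> T t f)"

definition fixed_vector :: "real set \<Rightarrow> (real \<Rightarrow> 'a::real_normed_vector \<Rightarrow>\<^sub>L 'a) \<Rightarrow> 'a \<Rightarrow> bool"
  where "fixed_vector J T f \<longleftrightarrow> (\<forall>t\<in>J. T t f = f)"

text \<open>The adjoint of \<open>T t\<close> maps a functional \<open>\<phi>\<close> to \<open>\<phi> o\<^sub>L T t\<close>.\<close>

definition fixed_functional ::
    "real set \<Rightarrow> (real \<Rightarrow> 'a::real_normed_vector \<Rightarrow>\<^sub>L 'a) \<Rightarrow> ('a \<Rightarrow>\<^sub>L real) \<Rightarrow> bool"
  where "fixed_functional J T \<phi> \<longleftrightarrow> (\<forall>t\<in>J. \<phi> o\<^sub>L T t = \<phi>)"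

definition positive_functional :: "('a::banach_lattice \<Rightarrow>\<^sub>L real) \<Rightarrow> bool"
  where "positive_functional \<phi> \<longleftrightarrow> (\<forall>f\<ge>0. 0 \<le> \<phi> f)"

lift_definition rank_one :: "('a::real_normed_vector \<Rightarrow>\<^sub>L real) \<Rightarrow> 'a \<Rightarrow> 'a \<Rightarrow>\<^sub>L 'a"
  is "\<lambda>\<phi> f\<^sub>0 g. \<phi> g *\<^sub>R f\<^sub>0"
  by (rule bounded_linear_scaleR_const)

definition at_infinity_in :: "real set \<Rightarrow> real filter"
  where "at_infinity_in J = inf at_top (principal J)"

definition converges_strongly ::
    "real set \<Rightarrow> (real \<Rightarrow> 'a::real_normed_vector \<Rightarrow>\<^sub>L 'a) \<Rightarrow> 'a \<Rightarrow>\<^sub>L 'a \<Rightarrow> bool"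
  where "converges_strongly J T P \<longleftrightarrow> (\<forall>f. ((\<lambda>t. T t f) \<longlongrightarrow> P f) (at_infinity_in J))"

definition lower_bound :: "real set \<Rightarrow> (real \<Rightarrow> 'a::banach_lattice \<Rightarrow>\<^sub>L 'a) \<Rightarrow> 'a \<Rightarrow> bool"
  where "lower_bound J T h \<longleftrightarrow>
    0 \<le> h \<and> (\<forall>f\<ge>0. norm f = 1 \<longrightarrow>
      ((\<lambda>t. norm (neg_part (T t f - h))) \<longlongrightarrow> 0) (at_infinity_in J))"

end

theory Submission
  imports Defs
begin

text \<open>
  If the semigroup converges to \<open>\<phi> \<otimes> f\<^sub>0\<close> with \<open>\<phi> \<ge> \<epsilon>\<close> on the positive part of the unit sphere, then
  every orbit starting there ends up near a vector that dominates \<open>\<epsilon> f\<^sub>0\<close>, so \<open>\<epsilon> f\<^sub>0\<close> is a lower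
  bound.

  For the converse, a non-zero lower bound can be improved to one that is fixed. The set of lower
  bounds is closed under finite suprema, under norm limits and under the operators of the
  semigroup, and it is norm bounded. As bounded increasing sequences converge in an AL-space, there
  is a greatest lower bound \<open>h\<close> (\<open>greatest_lower_bound_exists\<close>). All \<open>T\<^sub>s h\<close> are lower bounds, hence
  \<open>T\<^sub>s h \<le> h\<close>, and the orbit of \<open>h\<close> decreases to a fixed vector \<open>p\<close>. This vector is again a lower
  bound, and it is non-zero because the lower bound property keeps the orbit of \<open>h\<close> away from 0
  (\<open>fixed_lower_bound_exists\<close>).

  Every orbit of a positive \<open>f\<close> converges to a multiple of \<open>p\<close> (\<open>orbit_converges\<close>). Let \<open>l\<close> be
  the largest number such that the orbit is asymptotically above \<open>l p\<close>. If the excess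
  \<open>(T\<^sub>s f - l p)\<^sup>+\<close> did not tend to 0, then the orbit of the excess would itself come to lie above a
  fixed positive multiple of \<open>p\<close>, and \<open>l\<close> could be increased. The functional
  \<open>\<phi>\<close> is read off from the limits; its invariance, its linearity and its bound are inherited from
  the operators, and it is bounded below on the cone because \<open>l \<ge> \<parallel>f\<parallel>\<close>.

  Shifting by a fixed time \<open>s \<in> J\<close> does not affect statements about late times, both for
  \<open>J = \<nat>\<close> and for \<open>J = (0,\<infinity>)\<close> (\<open>eventually_shift\<close>); this treats the two cases at once.
\<close>

section \<open>Negative parts and the norm in Banach lattices\<close>

lemma neg_part_nonneg: "0 \<le> neg_part (x::'a::banach_lattice)"
  by (simp add: neg_part_def)

lemma neg_part_ge: "- x \<le> neg_part (x::'a::banach_lattice)"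
  by (simp add: neg_part_def)

lemma neg_part_least: "- x \<le> y \<Longrightarrow> 0 \<le> y \<Longrightarrow> neg_part x \<le> (y::'a::banach_lattice)"
  by (simp add: neg_part_def)

lemma neg_part_antimono: "x \<le> y \<Longrightarrow> neg_part y \<le> neg_part (x::'a::banach_lattice)"
  by (intro neg_part_least neg_part_nonneg order_trans[OF _ neg_part_ge]) simp

lemma neg_part_add: "neg_part (x + y) \<le> neg_part x + neg_part (y::'a::banach_lattice)"
  using add_mono[OF neg_part_ge neg_part_ge, of x y]
  by (intro neg_part_least) (simp_all add: neg_part_nonneg add_nonneg_nonneg)

lemma neg_part_eq_0: "0 \<le> x \<Longrightarrow> neg_part (x::'a::banach_lattice) = 0"
  by (intro antisym neg_part_least neg_part_nonneg) simp_all

lemma neg_part_scaleR_le: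
  "0 \<le> c \<Longrightarrow> neg_part (c *\<^sub>R x) \<le> c *\<^sub>R neg_part (x::'a::banach_lattice)"
  using scaleR_left_mono[OF neg_part_ge, of c x]
  by (intro neg_part_least) (simp_all add: neg_part_nonneg scaleR_nonneg_nonneg)

lemma neg_part_diff_sup:
  "neg_part (x - sup a b) \<le> neg_part (x - a) + neg_part (x - (b::'a::banach_lattice))"
proof (rule neg_part_least)
  have "a - x \<le> neg_part (x - a) + neg_part (x - b)"
    using add_mono[OF neg_part_ge[of "x - a"] neg_part_nonneg[of "x - b"]] by simp
  moreover have "b - x \<le> neg_part (x - a) + neg_part (x - b)"
    using add_mono[OF neg_part_nonneg[of "x - a"] neg_part_ge[of "x - b"]] by simp
  ultimately have "sup a b \<le> neg_part (x - a) + neg_part (x - b) + x"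
    by (simp add: diff_le_eq)
  then show "- (x - sup a b) \<le> neg_part (x - a) + neg_part (x - b)"
    by (simp add: diff_le_eq)
qed (simp add: neg_part_nonneg add_nonneg_nonneg)

lemma pos_neg_decomposition: "x = neg_part (- x) - neg_part (x::'a::banach_lattice)"
proof -
  have "neg_part y = pprt (- y)" for y :: 'a
    by (simp add: neg_part_def pprt_def)
  then show ?thesis
    by (simp add: pprt_neg nprt_neg flip: prts)
qed

lemma norm_mono: "0 \<le> x \<Longrightarrow> x \<le> y \<Longrightarrow> norm x \<le> norm (y::'a::banach_lattice)"
proof (rule norm_lattice)
  assume "0 \<le> x" "x \<le> y"
  then have "- x \<le> y"
    by (meson neg_le_0_iff_le order_trans)
  with \<open>x \<le> y\<close> show "sup x (- x) \<le> sup y (- y)"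
    by (meson le_supI order_trans sup_ge1)
qed

lemma norm_neg_part_le: "norm (neg_part x) \<le> norm (x::'a::banach_lattice)"
proof (rule norm_lattice)
  have "0 \<le> sup x (- x) + sup x (- x)"
    using add_mono[OF sup_ge1[of x "- x"] sup_ge2[of "- x" x]] by simp
  then have m: "0 \<le> sup x (- x)"
    by simp
  moreover have "- neg_part x \<le> sup x (- x)"
    using m neg_part_nonneg[of x] by (meson neg_le_0_iff_le order_trans)
  ultimately show "sup (neg_part x) (- neg_part x) \<le> sup x (- x)"
    by (simp add: neg_part_least)
qed

lemma tendsto_norm_neg_part_squeeze:
  fixes x :: "'b \<Rightarrow> 'a::banach_lattice"
  assumes "eventually (\<lambda>t. neg_part (x t) \<le> y t) F" "((\<lambda>t. norm (y t)) \<longlongrightarrow> 0) F"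
  shows "((\<lambda>t. norm (neg_part (x t))) \<longlongrightarrow> 0) F"
  by (rule tendsto_sandwich[OF _ _ tendsto_const assms(2)])
    (use assms(1) in \<open>auto elim!: eventually_mono intro: norm_mono neg_part_nonneg\<close>)

lemma limit_nonneg:
  fixes x :: "'b \<Rightarrow> 'a::banach_lattice"
  assumes "F \<noteq> bot" "(x \<longlongrightarrow> l) F" "eventually (\<lambda>t. 0 \<le> x t) F"
  shows "0 \<le> l"
proof -
  have "eventually (\<lambda>t. norm (neg_part l) \<le> norm (l - x t)) F"
    using assms(3)
  proof eventually_elim
    case (elim t)
    have "neg_part l \<le> neg_part (l - x t)"
      using elim by (intro neg_part_antimono) simp
    then show ?case
      by (rule order_trans[OF norm_mono[OF neg_part_nonneg] norm_neg_part_le])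
  qed
  moreover have "((\<lambda>t. norm (l - x t)) \<longlongrightarrow> 0) F"
    using tendsto_norm[OF tendsto_diff[OF tendsto_const[of l] assms(2)]] by simp
  ultimately have "norm (neg_part l) \<le> 0"
    by (rule tendsto_lowerbound[rotated, OF _ assms(1)])
  then show ?thesis
    using neg_part_ge[of l] by simp
qed

lemma limit_mono:
  fixes x y :: "'b \<Rightarrow> 'a::banach_lattice"
  assumes "F \<noteq> bot" "(x \<longlongrightarrow> l) F" "(y \<longlongrightarrow> m) F" "eventually (\<lambda>t. x t \<le> y t) F"
  shows "l \<le> m"
  using limit_nonneg[OF assms(1) tendsto_diff[OF assms(3,2)]] assms(4) by simp

section \<open>Monotone sequences in AL-spaces\<close>

lemma norm_diff_al: "0 \<le> x \<Longrightarrow> x \<le> y \<Longrightarrow> norm (y - x) = norm y - norm (x::'a::al_space)"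
  using norm_add_nonneg[of x "y - x"] by simp

text \<open>Additivity of the norm turns the increments of the norms into the norms of the increments, so
  the bounded monotone sequence of norms forces the vectors to form a Cauchy sequence.\<close>

lemma incseq_norm_bounded_convergent:
  fixes y :: "nat \<Rightarrow> 'a::al_space"
  assumes "incseq y" "\<And>n. 0 \<le> y n" "\<And>n. norm (y n) \<le> C"
  shows "convergent y"
proof -
  have "incseq (\<lambda>n. norm (y n))"
    using assms(1,2) by (auto simp: incseq_def intro: norm_mono)
  then have "convergent (\<lambda>n. norm (y n))"
    using assms(3) by (metis convergentI incseq_convergent)
  then have C: "Cauchy (\<lambda>n. norm (y n))"
    by (rule convergent_Cauchy)
  have d: "dist (y m) (y n) = dist (norm (y m)) (norm (y n))" for m n
  proof (cases "m \<le> n")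
    case True
    then show ?thesis
      using norm_diff_al[of "y m" "y n"] norm_mono[of "y m" "y n"] assms(1,2)
      by (simp add: dist_norm norm_minus_commute incseq_def)
  next
    case False
    then show ?thesis
      using norm_diff_al[of "y n" "y m"] norm_mono[of "y n" "y m"] assms(1,2)
      by (simp add: dist_norm incseq_def)
  qed
  have "Cauchy y"
    using C unfolding Cauchy_def d .
  then show ?thesis
    by (rule Cauchy_convergent)
qed

lemma decseq_nonneg_convergent:
  fixes y :: "nat \<Rightarrow> 'a::al_space"
  assumes "decseq y" "\<And>n. 0 \<le> y n"
  shows "convergent y"
proof -
  have "convergent (\<lambda>n. y 0 - y n)"
  proof (rule incseq_norm_bounded_convergent)
    show "incseq (\<lambda>n. y 0 - y n)"
      using assms(1) by (simp add: decseq_def incseq_def)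
    show nn: "0 \<le> y 0 - y n" for n
      using assms(1) by (simp add: decseq_def)
    show "norm (y 0 - y n) \<le> norm (y 0)" for n
      using assms(2) by (intro norm_mono nn) simp
  qed
  from convergent_diff[OF convergent_const[of "y 0"] this] show ?thesis
    by simp
qed

section \<open>Time sets and bounded positive semigroups\<close>

lemma eventually_at_infinity_in:
  "eventually P (at_infinity_in J) \<longleftrightarrow> (\<exists>N. \<forall>t\<in>J. N \<le> t \<longrightarrow> P t)"
  by (auto simp: at_infinity_in_def eventually_inf_principal eventually_at_top_linorder)

locale bounded_positive_semigroup =
  fixes J :: "real set" and T :: "real \<Rightarrow> 'a::al_space \<Rightarrow>\<^sub>L 'a"
  assumes time: "J = real ` {1..} \<or> J = {0<..}"
    and semigroup: "operator_semigroup J T"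
    and bounded: "bounded_family J T"
    and positive: "positive_family J T"
begin

abbreviation "F \<equiv> at_infinity_in J"

lemma time_pos: "t \<in> J \<Longrightarrow> 0 < t"
  using time by auto

lemma time_Suc: "real (Suc n) \<in> J"
  using time by (auto simp del: of_nat_Suc)

lemma time_add: "s \<in> J \<Longrightarrow> t \<in> J \<Longrightarrow> s + t \<in> J"
  using time by (auto simp flip: of_nat_add)

lemma time_diff: "s \<in> J \<Longrightarrow> t \<in> J \<Longrightarrow> s < t \<Longrightarrow> t - s \<in> J"
  using time by (auto simp flip: of_nat_diff)

lemma F_nontrivial: "F \<noteq> bot"
proof -
  have "\<exists>t\<in>J. N \<le> t" for N
    using time_Suc by (meson le_SucI linear of_nat_le_iff order_trans real_arch_simple)
  then show ?thesis
    unfolding trivial_limit_def eventually_at_infinity_in by blast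
qed

lemma eventually_time: "eventually (\<lambda>t. t \<in> J) F"
  unfolding eventually_at_infinity_in by blast

lemma eventually_shift:
  assumes s: "s \<in> J"
  shows "eventually (\<lambda>t. P (t + s)) F \<longleftrightarrow> eventually P F"
  unfolding eventually_at_infinity_in
proof safe
  fix N assume N: "\<forall>t\<in>J. N \<le> t \<longrightarrow> P (t + s)"
  (* The bound s + 1 makes t - s positive, and hence a time. *)
  have "P t" if "t \<in> J" "max (N + s) (s + 1) \<le> t" for t
    using N[rule_format, of "t - s"] time_diff[OF s \<open>t \<in> J\<close>] that by simp
  then show "\<exists>N. \<forall>t\<in>J. N \<le> t \<longrightarrow> P t" by blast
next
  fix N assume N: "\<forall>t\<in>J. N \<le> t \<longrightarrow> P t"
  have "P (t + s)" if "t \<in> J" "N \<le> t" for t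
    using N[rule_format, of "t + s"] time_add[OF \<open>t \<in> J\<close> s] time_pos[OF s] that by simp
  then show "\<exists>N. \<forall>t\<in>J. N \<le> t \<longrightarrow> P (t + s)" by blast
qed

lemma tendsto_shift: "s \<in> J \<Longrightarrow> ((\<lambda>t. g (t + s)) \<longlongrightarrow> l) F \<longleftrightarrow> (g \<longlongrightarrow> l) F"
  unfolding tendsto_def using eventually_shift[of s "\<lambda>t. g t \<in> _"] by simp

lemma T_add: "s \<in> J \<Longrightarrow> t \<in> J \<Longrightarrow> T (t + s) f = T t (T s f)"
  using semigroup by (simp add: operator_semigroup_def)

lemma T_nonneg: "t \<in> J \<Longrightarrow> 0 \<le> f \<Longrightarrow> 0 \<le> T t f"
  using positive by (simp add: positive_family_def)

lemma T_mono: "t \<in> J \<Longrightarrow> f \<le> g \<Longrightarrow> T t f \<le> T t g"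
  using T_nonneg[of t "g - f"] by (simp add: blinfun.diff_right)

lemma neg_part_T_le: "t \<in> J \<Longrightarrow> neg_part (T t f) \<le> T t (neg_part f)"
  using T_mono[OF _ neg_part_ge, of t f] T_nonneg[OF _ neg_part_nonneg, of t f]
  by (intro neg_part_least) (simp_all add: blinfun.minus_right)

definition M :: real
  where "M = (SOME M. 0 < M \<and> (\<forall>t\<in>J. norm (T t) \<le> M))"

lemma M_bound: "0 < M \<and> (\<forall>t\<in>J. norm (T t) \<le> M)"
proof -
  obtain C where "\<forall>t\<in>J. norm (T t) \<le> C"
    using bounded by (auto simp: bounded_family_def bdd_above_def)
  then have "0 < max 1 C \<and> (\<forall>t\<in>J. norm (T t) \<le> max 1 C)"
    by (simp add: max.coboundedI2)
  then show ?thesis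
    unfolding M_def by (rule someI)
qed

lemma M_pos: "0 < M"
  using M_bound by simp

lemma norm_T_le: "t \<in> J \<Longrightarrow> norm (T t f) \<le> M * norm f"
  using M_bound norm_blinfun[of "T t" f] by (meson mult_right_mono norm_ge_zero order_trans)

section \<open>Lower bounds\<close>

text \<open>By homogeneity the defining property extends from the unit sphere to the whole cone.\<close>

lemma lower_bound_scaled:
  assumes "lower_bound J T h" "0 \<le> f"
  shows "((\<lambda>t. norm (neg_part (T t f - norm f *\<^sub>R h))) \<longlongrightarrow> 0) F"
proof (cases "f = 0")
  case True
  then show ?thesis
    by (simp add: neg_part_eq_0)
next
  case False
  define g where "g = f /\<^sub>R norm f"
  have g: "0 \<le> g" "norm g = 1" "f = norm f *\<^sub>R g"
    using False assms(2) by (simp_all add: g_def scaleR_nonneg_nonneg)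
  have "((\<lambda>t. norm (neg_part (T t g - h))) \<longlongrightarrow> 0) F"
    using assms(1) g(1,2) by (simp add: lower_bound_def)
  from tendsto_mult_right_zero[OF this, of "norm f"]
  have l: "((\<lambda>t. norm (norm f *\<^sub>R neg_part (T t g - h))) \<longlongrightarrow> 0) F"
    by simp
  have "T t f - norm f *\<^sub>R h = norm f *\<^sub>R (T t g - h)" for t
    by (subst g(3)) (simp add: blinfun.scaleR_right scaleR_diff_right)
  then have "neg_part (T t f - norm f *\<^sub>R h) \<le> norm f *\<^sub>R neg_part (T t g - h)" for t
    by (simp add: neg_part_scaleR_le)
  then show ?thesis
    by (intro tendsto_norm_neg_part_squeeze[OF _ l]) simp
qed

text \<open>Adding the vanishing negative parts to \<open>x\<close> does not change its limit and puts it above \<open>h\<close>;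
  the order is closed.\<close>

lemma limit_ge_if_neg_part_vanishes:
  assumes "((\<lambda>t. norm (neg_part (x t - (h::'a)))) \<longlongrightarrow> 0) F" "(x \<longlongrightarrow> l) F"
  shows "h \<le> l"
proof -
  have "((\<lambda>t. x t + neg_part (x t - h)) \<longlongrightarrow> l + 0) F"
    using assms by (intro tendsto_add) (simp_all add: tendsto_norm_zero_iff)
  moreover have "h \<le> x t + neg_part (x t - h)" for t
    using neg_part_ge[of "x t - h"] by (simp add: diff_le_eq add.commute)
  then have "eventually (\<lambda>t. h \<le> x t + neg_part (x t - h)) F"
    by simp
  ultimately have "h \<le> l + 0"
    by (rule limit_mono[OF F_nontrivial tendsto_const])
  then show ?thesis
    by simp
qed

lemma norm_le_if_neg_part_vanishes:
  assumes "((\<lambda>t. norm (neg_part (T t f - h))) \<longlongrightarrow> 0) F" "0 \<le> h"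
  shows "norm h \<le> M * norm f"
proof -
  have "eventually (\<lambda>t. norm h \<le> M * norm f + norm (neg_part (T t f - h))) F"
    using eventually_time
  proof eventually_elim
    case (elim t)
    have "h \<le> T t f + neg_part (T t f - h)"
      using neg_part_ge[of "T t f - h"] by (simp add: diff_le_eq add.commute)
    then have "norm h \<le> norm (T t f + neg_part (T t f - h))"
      using assms(2) by (rule norm_mono[rotated])
    then show ?case
      using norm_triangle_ineq[of "T t f" "neg_part (T t f - h)"] norm_T_le[OF elim, of f] by linarith
  qed
  moreover have "((\<lambda>t. M * norm f + norm (neg_part (T t f - h))) \<longlongrightarrow> M * norm f + 0) F"
    by (intro tendsto_add tendsto_const assms(1))
  ultimately show ?thesis
    using tendsto_lowerbound[OF _ _ F_nontrivial] by fastforce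
qed

lemma norm_lower_bound_le:
  assumes "lower_bound J T h"
  shows "norm h \<le> M"
proof (cases "h = 0")
  case False
  define g where "g = h /\<^sub>R norm h"
  have g: "0 \<le> g" "norm g = 1" "0 \<le> h"
    using False assms by (simp_all add: g_def scaleR_nonneg_nonneg lower_bound_def)
  then have "((\<lambda>t. norm (neg_part (T t g - h))) \<longlongrightarrow> 0) F"
    using assms by (simp add: lower_bound_def)
  from norm_le_if_neg_part_vanishes[OF this g(3)] g(2) show ?thesis by simp
qed (use M_pos in simp)

lemma lower_bound_sup:
  assumes "lower_bound J T h" "lower_bound J T k"
  shows "lower_bound J T (sup h k)"
  unfolding lower_bound_def
proof safe
  show "0 \<le> sup h k"
    using assms(1) by (auto simp: lower_bound_def intro: le_supI1)
  fix f :: 'a assume "0 \<le> f" "norm f = 1"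
  then have "((\<lambda>t. neg_part (T t f - h) + neg_part (T t f - k)) \<longlongrightarrow> 0 + 0) F"
    using assms by (intro tendsto_add) (simp_all add: lower_bound_def tendsto_norm_zero_iff)
  then have l: "((\<lambda>t. norm (neg_part (T t f - h) + neg_part (T t f - k))) \<longlongrightarrow> 0) F"
    by (simp add: tendsto_norm_zero)
  show "((\<lambda>t. norm (neg_part (T t f - sup h k))) \<longlongrightarrow> 0) F"
    by (rule tendsto_norm_neg_part_squeeze[OF _ l]) (intro always_eventually allI neg_part_diff_sup)
qed

text \<open>Applying \<open>T s\<close> to the defining inequality of a lower bound only delays the orbit by \<open>s\<close>.\<close>

lemma lower_bound_T:
  assumes "lower_bound J T h" "s \<in> J"
  shows "lower_bound J T (T s h)"
  unfolding lower_bound_def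
proof safe
  show "0 \<le> T s h"
    using assms by (simp add: lower_bound_def T_nonneg)
  fix f :: 'a assume "0 \<le> f" "norm f = 1"
  then have "((\<lambda>t. neg_part (T t f - h)) \<longlongrightarrow> 0) F"
    using assms by (simp add: lower_bound_def tendsto_norm_zero_iff)
  then have "((\<lambda>t. T s (neg_part (T t f - h))) \<longlongrightarrow> T s 0) F"
    by (intro tendsto_intros)
  then have "((\<lambda>t. norm (T s (neg_part (T t f - h)))) \<longlongrightarrow> 0) F"
    by (simp add: tendsto_norm_zero blinfun.zero_right)
  moreover have "eventually (\<lambda>t. neg_part (T (t + s) f - T s h) \<le> T s (neg_part (T t f - h))) F"
    using eventually_time
  proof eventually_elim
    case (elim t)
    have "T (t + s) f - T s h = T s (T t f - h)"
      using T_add[OF elim assms(2)] by (simp add: blinfun.diff_right add.commute)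
    then show ?case
      using neg_part_T_le[OF assms(2)] by simp
  qed
  ultimately have "((\<lambda>t. norm (neg_part (T (t + s) f - T s h))) \<longlongrightarrow> 0) F"
    by (rule tendsto_norm_neg_part_squeeze[rotated])
  then show "((\<lambda>t. norm (neg_part (T t f - T s h))) \<longlongrightarrow> 0) F"
    using tendsto_shift[OF assms(2), of "\<lambda>t. norm (neg_part (T t f - T s h))"] by simp
qed

text \<open>Moving \<open>h\<close> by a distance less than \<open>e\<close> changes the norms of the negative parts by less than
  \<open>e\<close>, uniformly in time. This gives the closedness both of the set of lower bounds and of the set
  of multiples of a vector that lie asymptotically below a given orbit.\<close>

lemma neg_part_vanishes_approx:
  assumes "\<And>e. 0 < e \<Longrightarrow> \<exists>k. norm (k - h) < e \<and> ((\<lambda>t. norm (neg_part (T t f - k))) \<longlongrightarrow> 0) F"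
  shows "((\<lambda>t. norm (neg_part (T t f - h))) \<longlongrightarrow> 0) F"
proof (rule tendstoI)
  fix e :: real assume "0 < e"
  then obtain k where k: "norm (k - h) < e / 2"
      "((\<lambda>t. norm (neg_part (T t f - k))) \<longlongrightarrow> 0) F"
    using assms[of "e / 2"] by auto
  have "eventually (\<lambda>t. norm (neg_part (T t f - k)) < e / 2) F"
    using tendstoD[OF k(2), of "e / 2"] \<open>0 < e\<close> by simp
  then show "eventually (\<lambda>t. dist (norm (neg_part (T t f - h))) 0 < e) F"
  proof eventually_elim
    case (elim t)
    have "norm (neg_part (T t f - h)) \<le> norm (neg_part (T t f - k) + neg_part (k - h))"
      using neg_part_add[of "T t f - k" "k - h"] by (intro norm_mono neg_part_nonneg) simp
    also have "\<dots> \<le> norm (neg_part (T t f - k)) + norm (k - h)"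
      by (intro norm_triangle_le add_left_mono norm_neg_part_le)
    finally show ?case
      using elim k(1) by simp
  qed
qed

lemma lower_bound_limit:
  assumes "G \<noteq> bot" "(x \<longlongrightarrow> h) G" "eventually (\<lambda>i. lower_bound J T (x i)) G"
  shows "lower_bound J T h"
  unfolding lower_bound_def
proof safe
  have "eventually (\<lambda>i. 0 \<le> x i) G"
    using assms(3) by (rule eventually_mono) (simp add: lower_bound_def)
  then show "0 \<le> h"
    by (rule limit_nonneg[OF assms(1,2)])
  fix f :: 'a assume f: "0 \<le> f" "norm f = 1"
  show "((\<lambda>t. norm (neg_part (T t f - h))) \<longlongrightarrow> 0) F"
  proof (rule neg_part_vanishes_approx)
    fix e :: real assume "0 < e"
    then have "eventually (\<lambda>i. dist (x i) h < e \<and> lower_bound J T (x i)) G"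
      by (intro eventually_conj tendstoD[OF assms(2)] assms(3))
    then obtain i where "dist (x i) h < e" "lower_bound J T (x i)"
      using assms(1) eventually_happens' by blast
    then show "\<exists>k. norm (k - h) < e \<and> ((\<lambda>t. norm (neg_part (T t f - k))) \<longlongrightarrow> 0) F"
      using f by (auto simp: lower_bound_def dist_norm)
  qed
qed

text \<open>Finite suprema of lower bounds whose norms approach the supremum of all their norms increase
  to a lower bound \<open>h\<close> of maximal norm. For another lower bound \<open>k\<close> the vector \<open>sup h k\<close> is a lower
  bound above \<open>h\<close> and of no larger norm, and the norm is strictly monotone on the cone.\<close>

lemma greatest_lower_bound_exists:
  assumes "lower_bound J T k0"
  obtains h where "lower_bound J T h" "\<And>k. lower_bound J T k \<Longrightarrow> k \<le> h"
proof -
  define s where "s = Sup (norm ` {h. lower_bound J T h})"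
  have bdd: "bdd_above (norm ` {h. lower_bound J T h})"
    using norm_lower_bound_le by (auto simp: bdd_above_def)
  have le_s: "norm h \<le> s" if "lower_bound J T h" for h
    unfolding s_def using that by (intro cSup_upper bdd) simp
  have "\<exists>h. lower_bound J T h \<and> s - 1 / Suc n < norm h" for n
    using less_cSup_iff[OF _ bdd, of "s - 1 / Suc n"] assms by (auto simp flip: s_def)
  then obtain x where x: "\<And>n. lower_bound J T (x n)" "\<And>n. s - 1 / Suc n < norm (x n)"
    by metis
  define y where "y = rec_nat (x 0) (\<lambda>n. sup (x (Suc n)))"
  have y_simps: "y 0 = x 0" "y (Suc n) = sup (x (Suc n)) (y n)" for n
    by (simp_all add: y_def)
  have y: "lower_bound J T (y n)" for n
    by (induction n) (simp_all add: y_simps x lower_bound_sup)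
  have "incseq y"
    by (rule incseq_SucI) (simp add: y_simps)
  moreover have y0: "0 \<le> y n" for n
    using y by (simp add: lower_bound_def)
  ultimately obtain h where h: "y \<longlonglongrightarrow> h"
    using incseq_norm_bounded_convergent[of y s] le_s[OF y] by (auto simp: convergent_def)
  have lb: "lower_bound J T h"
    by (rule lower_bound_limit[OF _ h]) (simp_all add: y)
  have x_y: "x n \<le> y n" for n
    by (cases n) (simp_all add: y_simps)
  have "norm (x n) \<le> norm (y n)" for n
    using x(1) x_y by (intro norm_mono) (simp_all add: lower_bound_def)
  then have "s - 1 / Suc n \<le> norm (y n)" for n
    using x(2) by (meson less_imp_le order_trans)
  moreover have "(\<lambda>n. s - 1 / Suc n) \<longlonglongrightarrow> s - 0"
    by (intro tendsto_diff tendsto_const LIMSEQ_Suc[OF lim_1_over_n])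
  ultimately have s_le: "s \<le> norm h"
    using LIMSEQ_le[OF _ tendsto_norm[OF h]] by fastforce
  have "k \<le> h" if "lower_bound J T k" for k
  proof -
    have "norm (sup h k - h) = norm (sup h k) - norm h"
      using lb by (intro norm_diff_al) (simp_all add: lower_bound_def)
    also have "\<dots> \<le> 0"
      using le_s[OF lower_bound_sup[OF lb that]] s_le by simp
    finally have "sup h k = h"
      by simp
    then show ?thesis
      by (metis sup_ge2)
  qed
  with lb show thesis
    by (rule that)
qed

text \<open>The greatest lower bound \<open>h\<close> satisfies \<open>T s h \<le> h\<close>, because \<open>T s h\<close> is again a lower bound.
  Its orbit therefore decreases, and the limit is fixed. The limit is non-zero since it dominates
  \<open>norm h *\<^sub>R h\<close>.\<close>

lemma fixed_lower_bound_exists: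
  assumes "lower_bound J T k" "k \<noteq> 0"
  obtains p where "lower_bound J T p" "p \<noteq> 0" "fixed_vector J T p"
proof -
  obtain h where h: "lower_bound J T h" "\<And>k. lower_bound J T k \<Longrightarrow> k \<le> h"
    using greatest_lower_bound_exists[OF assms(1)] by blast
  have h0: "0 \<le> h"
    using h(1) by (simp add: lower_bound_def)
  have "h \<noteq> 0"
    using h(2)[OF assms(1)] assms by (auto simp: lower_bound_def)
  have anti: "T t h \<le> T s h" if "s \<in> J" "t \<in> J" "s \<le> t" for s t
  proof (cases "s = t")
    case False
    with that have r: "t - s \<in> J"
      by (intro time_diff) auto
    have "T t h = T s (T (t - s) h)"
      using T_add[OF r that(1)] by simp
    also have "\<dots> \<le> T s h"
      by (intro T_mono that h(2) lower_bound_T[OF h(1)] r)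
    finally show ?thesis .
  qed simp
  define y where "y n = T (real (Suc n)) h" for n
  have "decseq y"
    unfolding y_def decseq_def by (intro allI impI anti time_Suc) simp
  moreover have "0 \<le> y n" for n
    unfolding y_def by (intro T_nonneg time_Suc h0)
  ultimately obtain p where p: "y \<longlonglongrightarrow> p"
    using decseq_nonneg_convergent by (auto simp: convergent_def)
  have p_le: "p \<le> T t h" if "t \<in> J" for t
  proof -
    obtain N where N: "t \<le> real N"
      using real_arch_simple by blast
    have "eventually (\<lambda>n. y n \<le> T t h) sequentially"
      using eventually_ge_at_top[of N]
      by eventually_elim (use N in \<open>auto simp: y_def simp del: of_nat_Suc intro!: anti that time_Suc\<close>)
    then show ?thesis
      by (intro limit_mono[OF _ p tendsto_const]) simp_all
  qed
  have lim: "((\<lambda>t. T t h) \<longlongrightarrow> p) F"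
  proof (rule tendstoI)
    fix e :: real assume "0 < e"
    then obtain n where n: "dist (y n) p < e"
      using tendstoD[OF p] by (meson eventually_sequentially order_refl)
    have "dist (T t h) p < e" if "t \<in> J" "real (Suc n) \<le> t" for t
    proof -
      have "norm (T t h - p) \<le> norm (y n - p)"
        unfolding y_def using p_le that anti[OF time_Suc that] by (intro norm_mono) simp_all
      then show ?thesis
        using n by (simp add: dist_norm)
    qed
    then show "eventually (\<lambda>t. dist (T t h) p < e) F"
      unfolding eventually_at_infinity_in by blast
  qed
  have "lower_bound J T p"
    by (rule lower_bound_limit[OF _ p]) (simp_all add: y_def lower_bound_T[OF h(1) time_Suc] del: of_nat_Suc)
  moreover have "norm h *\<^sub>R h \<le> p"
    by (rule limit_ge_if_neg_part_vanishes[OF lower_bound_scaled[OF h(1) h0] lim])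
  then have "p \<noteq> 0"
    using norm_mono[of "norm h *\<^sub>R h" p] h0 \<open>h \<noteq> 0\<close> by (auto simp: scaleR_nonneg_nonneg mult_le_0_iff)
  moreover have "fixed_vector J T p"
    unfolding fixed_vector_def
  proof
    fix s assume s: "s \<in> J"
    have "((\<lambda>t. T s (T t h)) \<longlongrightarrow> T s p) F"
      by (intro tendsto_intros lim)
    moreover have "eventually (\<lambda>t. T s (T t h) = T (t + s) h) F"
      using eventually_time by eventually_elim (metis T_add add.commute s)
    ultimately have "((\<lambda>t. T (t + s) h) \<longlongrightarrow> T s p) F"
      using tendsto_cong by fastforce
    then have "((\<lambda>t. T t h) \<longlongrightarrow> T s p) F"
      using tendsto_shift[OF s, of "\<lambda>t. T t h"] by simp
    then show "T s p = p"
      using tendsto_unique[OF F_nontrivial _ lim] by blast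
  qed
  ultimately show thesis
    by (rule that)
qed

section \<open>Convergence of orbits\<close>

text \<open>Take the largest \<open>l\<close> such that the orbit of \<open>f\<close> is asymptotically above \<open>l *\<^sub>R p\<close>, and let
  \<open>u t = T t f - l *\<^sub>R p\<close>, whose negative part vanishes asymptotically. Since \<open>p\<close> is fixed,
  \<open>u (t + s) = T t (u s)\<close>. If the positive part of \<open>u s\<close> had norm at least \<open>c > 0\<close> for arbitrarily
  late \<open>s\<close>, then the lower bound property applied to this positive part would push the orbit of \<open>f\<close>
  asymptotically above \<open>(l + c) *\<^sub>R p\<close>, contrary to the choice of \<open>l\<close>. So \<open>u\<close> tends to 0.\<close>

lemma orbit_converges:
  assumes p: "lower_bound J T p" "p \<noteq> 0" "fixed_vector J T p" and f: "0 \<le> f"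
  obtains l where "norm f \<le> l" "((\<lambda>t. T t f) \<longlongrightarrow> l *\<^sub>R p) F"
proof -
  define A where "A = {l. ((\<lambda>t. norm (neg_part (T t f - l *\<^sub>R p))) \<longlongrightarrow> 0) F}"
  define l where "l = Sup A"
  have p0: "0 \<le> p"
    using p(1) by (simp add: lower_bound_def)
  have fA: "norm f \<in> A"
    using lower_bound_scaled[OF p(1) f] by (simp add: A_def)
  have "r \<le> M * norm f / norm p" if "r \<in> A" for r
  proof (cases "0 \<le> r")
    case True
    then have "norm (r *\<^sub>R p) \<le> M * norm f"
      using that p0 by (intro norm_le_if_neg_part_vanishes) (simp_all add: A_def scaleR_nonneg_nonneg)
    then show ?thesis
      using True p(2) by (simp add: pos_le_divide_eq)
  next
    case False
    moreover have "0 \<le> M * norm f / norm p"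
      using M_pos by simp
    ultimately show ?thesis
      by linarith
  qed
  then have bdd: "bdd_above A"
    by (auto simp: bdd_above_def)
  have fl: "norm f \<le> l"
    unfolding l_def by (rule cSup_upper[OF fA bdd])
  have "l \<in> A"
    unfolding A_def mem_Collect_eq
  proof (rule neg_part_vanishes_approx)
    fix e :: real assume "0 < e"
    then obtain r where r: "r \<in> A" "l - e / norm p < r"
      using less_cSup_iff[OF _ bdd, of "l - e / norm p"] fA p(2) by (auto simp flip: l_def)
    then have "r \<le> l"
      unfolding l_def by (intro cSup_upper bdd)
    have "norm (r *\<^sub>R p - l *\<^sub>R p) = (l - r) * norm p"
      using \<open>r \<le> l\<close> by (simp flip: scaleR_diff_left)
    also have "\<dots> < e"
      using r(2) p(2) by (simp add: field_simps)
    finally show "\<exists>k. norm (k - l *\<^sub>R p) < e \<and> ((\<lambda>t. norm (neg_part (T t f - k))) \<longlongrightarrow> 0) F"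
      using r(1) by (auto simp: A_def)
  qed
  define u where "u t = T t f - l *\<^sub>R p" for t
  have neg_u: "((\<lambda>t. neg_part (u t)) \<longlongrightarrow> 0) F"
    using \<open>l \<in> A\<close> by (simp add: A_def u_def tendsto_norm_zero_iff)
  have u_add: "u (t + s) = T t (u s)" if "s \<in> J" "t \<in> J" for s t
    using p(3) that by (simp add: u_def T_add blinfun.diff_right blinfun.scaleR_right fixed_vector_def)
  have "((\<lambda>t. neg_part (- u t)) \<longlongrightarrow> 0) F"
  proof (rule ccontr)
    assume "\<not> ?thesis"
    then obtain c where c: "0 < c" "\<not> eventually (\<lambda>t. norm (neg_part (- u t)) < c) F"
      by (auto simp: tendsto_iff)
    have "((\<lambda>t. norm (neg_part (T t f - (l + c) *\<^sub>R p))) \<longlongrightarrow> 0) F"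
    proof (rule tendstoI)
      fix e :: real assume e: "0 < e"
      have "eventually (\<lambda>s. s \<in> J \<and> norm (neg_part (u s)) < e / (2 * M)) F"
        using tendstoD[OF neg_u, of "e / (2 * M)"] e M_pos eventually_time
        by (simp add: eventually_conj_iff)
      moreover have "frequently (\<lambda>s. c \<le> norm (neg_part (- u s))) F"
        using c(2) by (simp add: frequently_def not_le)
      ultimately obtain s where s: "s \<in> J" "norm (neg_part (u s)) < e / (2 * M)"
          "c \<le> norm (neg_part (- u s))"
        using frequently_ex[OF frequently_eventually_conj] by blast
      (* v is the positive part of u s; the lower bound property lifts its late orbit above c *\<^sub>R p, and
         the negative part of u s costs at most e / 2. *)
      define v where "v = neg_part (- u s)"
      have us: "u s = v - neg_part (u s)"
        unfolding v_def by (rule pos_neg_decomposition)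
      have "((\<lambda>t. norm (neg_part (T t v - norm v *\<^sub>R p))) \<longlongrightarrow> 0) F"
        by (rule lower_bound_scaled[OF p(1)]) (simp add: v_def neg_part_nonneg)
      from tendstoD[OF this, of "e / 2"] e
      have "eventually (\<lambda>t. norm (neg_part (T t v - norm v *\<^sub>R p)) < e / 2) F"
        by simp
      with eventually_time
      have "eventually (\<lambda>t. dist (norm (neg_part (T (t + s) f - (l + c) *\<^sub>R p))) 0 < e) F"
      proof eventually_elim
        case (elim t)
        have "c *\<^sub>R p \<le> norm v *\<^sub>R p"
          using s(3) p0 by (intro scaleR_right_mono) (simp_all add: v_def)
        then have "neg_part (T t v - c *\<^sub>R p) \<le> neg_part (T t v - norm v *\<^sub>R p)"
          by (intro neg_part_antimono) simp
        moreover have "T (t + s) f - (l + c) *\<^sub>R p = (T t v - c *\<^sub>R p) + T t (- neg_part (u s))"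
        proof -
          have "T (t + s) f - (l + c) *\<^sub>R p = u (t + s) - c *\<^sub>R p"
            by (simp add: u_def scaleR_add_left)
          also have "u (t + s) = T t v + T t (- neg_part (u s))"
            by (subst u_add[OF s(1) elim(1)], subst us) (simp add: blinfun.diff_right blinfun.minus_right)
          finally show ?thesis
            by simp
        qed
        ultimately have "neg_part (T (t + s) f - (l + c) *\<^sub>R p)
            \<le> neg_part (T t v - norm v *\<^sub>R p) + neg_part (T t (- neg_part (u s)))"
          using order_trans[OF neg_part_add add_right_mono] by simp
        then have "norm (neg_part (T (t + s) f - (l + c) *\<^sub>R p))
            \<le> norm (neg_part (T t v - norm v *\<^sub>R p) + neg_part (T t (- neg_part (u s))))"
          by (rule norm_mono[OF neg_part_nonneg])
        also have "\<dots> \<le> norm (neg_part (T t v - norm v *\<^sub>R p)) + norm (T t (- neg_part (u s)))"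
          by (intro norm_triangle_le add_left_mono norm_neg_part_le)
        also have "norm (T t (- neg_part (u s))) \<le> M * norm (neg_part (u s))"
          using norm_T_le[OF elim(1), of "- neg_part (u s)"] by simp
        also have "M * norm (neg_part (u s)) < e / 2"
          using s(2) M_pos by (simp add: field_simps)
        finally show ?case
          using elim(2) by simp
      qed
      then show "eventually (\<lambda>t. dist (norm (neg_part (T t f - (l + c) *\<^sub>R p))) 0 < e) F"
        using eventually_shift[OF s(1), of "\<lambda>t. dist (norm (neg_part (T t f - (l + c) *\<^sub>R p))) 0 < e"]
        by simp
    qed
    then have "l + c \<le> l"
      unfolding l_def using bdd by (intro cSup_upper) (simp_all add: A_def)
    with c(1) show False
      by simp
  qed
  from tendsto_diff[OF this neg_u] have "(u \<longlongrightarrow> 0) F"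
    by (simp flip: pos_neg_decomposition)
  from tendsto_add[OF this tendsto_const[of "l *\<^sub>R p"]]
  have "((\<lambda>t. T t f) \<longlongrightarrow> l *\<^sub>R p) F"
    by (simp add: u_def)
  with fl show thesis
    by (rule that)
qed

text \<open>The coefficient of the limit of the orbit of \<open>f\<close> is determined by \<open>f\<close>, since \<open>f0\<close> has norm 1;
  the linearity and the invariance of \<open>\<phi>\<close> and its value at \<open>f0\<close> follow from this uniqueness. Decomposing a
  vector into its positive and its negative part reduces convergence to the cone. Normalising the
  fixed lower bound \<open>p\<close> multiplies the coefficients by \<open>norm p\<close>, which is therefore the value of
  \<open>\<epsilon>\<close>.\<close>

lemma rank_one_limit_if_lower_bound:
  assumes "lower_bound J T h" "h \<noteq> 0"
  obtains f0 and \<phi> :: "'a \<Rightarrow>\<^sub>L real" and \<epsilon> where "0 \<le> f0" "norm f0 = 1" "fixed_vector J T f0"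
    "positive_functional \<phi>" "fixed_functional J T \<phi>" "\<phi> f0 = 1"
    "0 < \<epsilon>" "\<And>f. 0 \<le> f \<Longrightarrow> norm f = 1 \<Longrightarrow> \<epsilon> \<le> \<phi> f"
    "converges_strongly J T (rank_one \<phi> f0)"
proof -
  obtain p where p: "lower_bound J T p" "p \<noteq> 0" "fixed_vector J T p"
    using fixed_lower_bound_exists[OF assms] by blast
  define f0 where "f0 = p /\<^sub>R norm p"
  have f0: "0 \<le> f0" "norm f0 = 1"
    using p by (simp_all add: f0_def lower_bound_def scaleR_nonneg_nonneg)
  have fix0: "T t f0 = f0" if "t \<in> J" for t
    using p(3) that by (simp add: f0_def fixed_vector_def blinfun.scaleR_right)
  have pos: "\<exists>l. norm f * norm p \<le> l \<and> ((\<lambda>t. T t f) \<longlongrightarrow> l *\<^sub>R f0) F" if f: "0 \<le> f" for f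
  proof -
    obtain l where l: "norm f \<le> l" "((\<lambda>t. T t f) \<longlongrightarrow> l *\<^sub>R p) F"
      using orbit_converges[OF p f] by blast
    have "l *\<^sub>R p = (l * norm p) *\<^sub>R f0"
      using p(2) by (simp add: f0_def)
    with l(2) have "((\<lambda>t. T t f) \<longlongrightarrow> (l * norm p) *\<^sub>R f0) F"
      by simp
    then show ?thesis
      using mult_right_mono[OF l(1) norm_ge_zero] by blast
  qed
  have "\<exists>l. ((\<lambda>t. T t f) \<longlongrightarrow> l *\<^sub>R f0) F" for f
  proof -
    obtain a where a: "((\<lambda>t. T t (neg_part (- f))) \<longlongrightarrow> a *\<^sub>R f0) F"
      using pos[OF neg_part_nonneg] by blast
    obtain b where b: "((\<lambda>t. T t (neg_part f)) \<longlongrightarrow> b *\<^sub>R f0) F"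
      using pos[OF neg_part_nonneg] by blast
    from tendsto_diff[OF a b]
    have "((\<lambda>t. T t (neg_part (- f) - neg_part f)) \<longlongrightarrow> (a - b) *\<^sub>R f0) F"
      by (simp add: blinfun.diff_right scaleR_diff_left)
    then show ?thesis
      by (auto simp flip: pos_neg_decomposition)
  qed
  then obtain \<psi> where \<psi>: "\<And>f. ((\<lambda>t. T t f) \<longlongrightarrow> \<psi> f *\<^sub>R f0) F"
    by metis
  have unique: "\<psi> f = l" if "((\<lambda>t. T t f) \<longlongrightarrow> l *\<^sub>R f0) F" for f l
    using tendsto_unique[OF F_nontrivial \<psi> that] f0(2) by auto
  have "bounded_linear \<psi>"
  proof (rule bounded_linear_intro)
    show "\<psi> (f + g) = \<psi> f + \<psi> g" for f g
      using tendsto_add[OF \<psi> \<psi>, of f g]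
      by (intro unique) (simp add: blinfun.add_right scaleR_add_left)
    show "\<psi> (r *\<^sub>R f) = r *\<^sub>R \<psi> f" for r f
      using tendsto_scaleR[OF tendsto_const[of r] \<psi>, of f]
      by (intro unique) (simp add: blinfun.scaleR_right)
    show "norm (\<psi> f) \<le> norm f * M" for f
    proof -
      have "norm (\<psi> f *\<^sub>R f0) \<le> M * norm f"
        by (rule tendsto_upperbound[OF tendsto_norm[OF \<psi>] _ F_nontrivial])
          (use eventually_time in \<open>auto elim!: eventually_mono intro: norm_T_le\<close>)
      then show ?thesis
        using f0(2) by (simp add: mult.commute)
    qed
  qed
  then obtain \<phi> where \<phi>: "blinfun_apply \<phi> = \<psi>"
    using bounded_linear_Blinfun_apply by blast
  have ge: "norm f * norm p \<le> \<psi> f" if "0 \<le> f" for f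
    using pos[OF that] unique by blast
  show thesis
  proof (rule that[of f0 \<phi> "norm p"])
    show "fixed_vector J T f0"
      by (simp add: fixed_vector_def fix0)
    have "0 \<le> \<psi> f" if "0 \<le> f" for f
      using ge[OF that] by (meson mult_nonneg_nonneg norm_ge_zero order_trans)
    then show "positive_functional \<phi>"
      by (simp add: positive_functional_def \<phi>)
    have "\<psi> (T s f) = \<psi> f" if "s \<in> J" for s f
    proof (rule unique)
      have "((\<lambda>t. T (t + s) f) \<longlongrightarrow> \<psi> f *\<^sub>R f0) F"
        using tendsto_shift[OF that, of "\<lambda>t. T t f"] \<psi> by simp
      moreover have "eventually (\<lambda>t. T (t + s) f = T t (T s f)) F"
        using eventually_time by eventually_elim (simp add: T_add that)
      ultimately show "((\<lambda>t. T t (T s f)) \<longlongrightarrow> \<psi> f *\<^sub>R f0) F"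
        using tendsto_cong by fastforce
    qed
    then show "fixed_functional J T \<phi>"
      by (auto simp: fixed_functional_def \<phi> intro!: blinfun_eqI)
    have "((\<lambda>t. T t f0) \<longlongrightarrow> 1 *\<^sub>R f0) F"
      by (rule tendsto_eventually) (use eventually_time in \<open>auto elim!: eventually_mono simp: fix0\<close>)
    then show "\<phi> f0 = 1"
      unfolding \<phi> by (rule unique)
    show "norm p \<le> \<phi> f" if "0 \<le> f" "norm f = 1" for f
      using ge[OF that(1)] that(2) by (simp add: \<phi>)
    show "converges_strongly J T (rank_one \<phi> f0)"
      using \<psi> by (simp add: converges_strongly_def rank_one.rep_eq \<phi>)
    show "0 < norm p"
      using p(2) by simp
  qed (fact f0)+
qed

lemma lower_bound_if_rank_one_limit:
  fixes \<phi> :: "'a \<Rightarrow>\<^sub>L real"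
  assumes "0 \<le> f0" "0 \<le> \<epsilon>" "\<And>f. 0 \<le> f \<Longrightarrow> norm f = 1 \<Longrightarrow> \<epsilon> \<le> \<phi> f"
    and "converges_strongly J T (rank_one \<phi> f0)"
  shows "lower_bound J T (\<epsilon> *\<^sub>R f0)"
  unfolding lower_bound_def
proof safe
  show "0 \<le> \<epsilon> *\<^sub>R f0"
    using assms(1,2) by (rule scaleR_nonneg_nonneg[rotated])
  fix f :: 'a assume f: "0 \<le> f" "norm f = 1"
  have "((\<lambda>t. T t f) \<longlongrightarrow> \<phi> f *\<^sub>R f0) F"
    using assms(4) by (simp add: converges_strongly_def rank_one.rep_eq)
  then have l: "((\<lambda>t. norm (T t f - \<phi> f *\<^sub>R f0)) \<longlongrightarrow> 0) F"
    by (simp add: tendsto_norm_zero LIM_zero_iff)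
  have le: "norm (neg_part (T t f - \<epsilon> *\<^sub>R f0)) \<le> norm (T t f - \<phi> f *\<^sub>R f0)" for t
  proof -
    have "\<epsilon> *\<^sub>R f0 \<le> \<phi> f *\<^sub>R f0"
      using assms(3)[OF f] assms(1) by (rule scaleR_right_mono)
    then have "neg_part (T t f - \<epsilon> *\<^sub>R f0) \<le> neg_part (T t f - \<phi> f *\<^sub>R f0)"
      by (intro neg_part_antimono) simp
    then show ?thesis
      by (rule order_trans[OF norm_mono[OF neg_part_nonneg] norm_neg_part_le])
  qed
  show "((\<lambda>t. norm (neg_part (T t f - \<epsilon> *\<^sub>R f0))) \<longlongrightarrow> 0) F"
    by (rule Lim_null_comparison[OF always_eventually l]) (simp add: le)
qed

end

section \<open>The characterisation\<close>

theorem corollary3p5: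
  fixes J :: "real set" and T :: "real \<Rightarrow> 'a::al_space \<Rightarrow>\<^sub>L 'a"
  assumes "J = real ` {1..} \<or> J = {0<..}"
    and "operator_semigroup J T"
    and "bounded_family J T"
    and "positive_family J T"
  shows "(\<exists>(f\<^sub>0 :: 'a) (\<phi> :: 'a \<Rightarrow>\<^sub>L real).
            0 \<le> f\<^sub>0 \<and> norm f\<^sub>0 = 1 \<and> fixed_vector J T f\<^sub>0
          \<and> positive_functional \<phi> \<and> fixed_functional J T \<phi>
          \<and> \<phi> f\<^sub>0 = 1
          \<and> (\<exists>\<epsilon>>0. \<forall>f\<ge>0. norm f = 1 \<longrightarrow> \<phi> f \<ge> \<epsilon>)
          \<and> converges_strongly J T (rank_one \<phi> f\<^sub>0))
     \<longleftrightarrow> (\<exists>h. h \<noteq> 0 \<and> lower_bound J T h)"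
proof -
  interpret bounded_positive_semigroup J T
    using assms by unfold_locales
  show ?thesis
  proof safe
    fix f\<^sub>0 :: 'a and \<phi> :: "'a \<Rightarrow>\<^sub>L real" and \<epsilon> :: real
    assume a: "0 \<le> f\<^sub>0" "norm f\<^sub>0 = 1" "0 < \<epsilon>" "\<forall>f\<ge>0. norm f = 1 \<longrightarrow> \<epsilon> \<le> \<phi> f"
      "converges_strongly J T (rank_one \<phi> f\<^sub>0)"
    have "lower_bound J T (\<epsilon> *\<^sub>R f\<^sub>0)"
      by (rule lower_bound_if_rank_one_limit[of _ _ \<phi>]) (use a in auto)
    moreover have "\<epsilon> *\<^sub>R f\<^sub>0 \<noteq> 0"
      using a(2,3) by auto
    ultimately show "\<exists>h. h \<noteq> 0 \<and> lower_bound J T h"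
      by blast
  next
    fix h assume "h \<noteq> 0" "lower_bound J T h"
    from rank_one_limit_if_lower_bound[OF this(2,1)]
    obtain f0 and \<phi> :: "'a \<Rightarrow>\<^sub>L real" and \<epsilon>
      where l: "0 \<le> f0" "norm f0 = 1" "fixed_vector J T f0"
        "positive_functional \<phi>" "fixed_functional J T \<phi>" "\<phi> f0 = 1"
        "0 < \<epsilon>" "\<And>f. 0 \<le> f \<Longrightarrow> norm f = 1 \<Longrightarrow> \<epsilon> \<le> \<phi> f"
        "converges_strongly J T (rank_one \<phi> f0)"
      by metis
    show "\<exists>f\<^sub>0 (\<phi> :: 'a \<Rightarrow>\<^sub>L real). 0 \<le> f\<^sub>0 \<and> norm f\<^sub>0 = 1 \<and> fixed_vector J T f\<^sub>0
        \<and> positive_functional \<phi> \<and> fixed_functional J T \<phi> \<and> \<phi> f\<^sub>0 = 1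
        \<and> (\<exists>\<epsilon>>0. \<forall>f\<ge>0. norm f = 1 \<longrightarrow> \<phi> f \<ge> \<epsilon>)
        \<and> converges_strongly J T (rank_one \<phi> f\<^sub>0)"
      by (intro exI[of _ f0] exI[of _ \<phi>] exI[of _ \<epsilon>] conjI allI impI l)
  qed
qed

end
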